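(* For every integer $n\ge1$, every suffix weight $p_a$ ($0\le a\le n-1$) and every adjacent weight $q_i$ ($0\le i\le n-2$), defined in the context, is strictly positive.
   Context: Let $n\ge1$ be an integer, let $r\in(0,1)$ be the unique solution in $(0,1)$ of $r^n(1+n(1+r))=1$, and put $h=1+r$, $\alpha=1-r$. For integers $s,t\ge 0$ put $\sigma(s,t)=(s+1)t\left[\alpha+\frac h2(t-s-1)\right]$. For $i=0,\ldots,n-2$ set $$\mathsf Z_i=\frac{2hi+3+r-\alpha r^{-2i-2}}{h^2},\qquad \mathsf Y_i=\frac{\mathsf Z_i}{n-i},\qquad \mathsf W_i=\mathsf Y_i-3\mathsf Y_{i-1}+3\mathsf Y_{i-2}-\mathsf Y_{i-3},$$ where $\mathsf Y_j=0$ for $j<0$. With $p_{-1}=0$, define the suffix weights recursively by $$p_i=\frac{\mathsf W_i+(n-i+4)p_{i-1}}{n-i-1},\qquad i=0,\ldots,n-2,$$ the adjacent weights by $$q_i=\frac{1}{\alpha}\Bigl(i+1-\sum_{a=0}^{i}p_a\,\sigma(i-a,n-i)\Bigr),\qquad i=0,\ldots,n-2,$$ and the final suffix weight by $$p_{n-1}=\frac1\alpha\Bigl(n-\sum_{a=0}^{n-2}p_a(n-a)\left[\alpha-\frac h2(n-1-a)\right]\Bigr).$$ Empty ranges have their usual meaning: for $n=1$ there are no $q_i$, and $p_0=1/\alpha$. *)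

theory Defs
  imports Complex_Main
begin

definition r_of :: "nat \<Rightarrow> real" where
  "r_of n = (THE r. 0 < r \<and> r < 1 \<and> r ^ n * (1 + real n * (1 + r)) = 1)"

text \<open>The description defining \<^const>\<open>r_of\<close> is proper for every \<open>n \<ge> 1\<close>.\<close>

lemma r_of_ex1:
  assumes "n \<ge> 1"
  shows "\<exists>!r::real. 0 < r \<and> r < 1 \<and> r ^ n * (1 + real n * (1 + r)) = 1"
proof -
  define f where "f = (\<lambda>r::real. r ^ n * (1 + real n * (1 + r)))"
  have less: "f x < f y" if "0 \<le> x" "x < y" for x y
  proof -
    have "x ^ n < y ^ n"
      using that assms by (intro power_strict_mono) auto
    moreover have "1 + real n * (1 + x) \<le> 1 + real n * (1 + y)"
      using that by (simp add: mult_left_mono)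
    moreover have "0 < 1 + real n * (1 + x)"
      using that by (simp add: add_pos_nonneg)
    ultimately show ?thesis
      unfolding f_def using that by (intro mult_less_le_imp_less) auto
  qed
  have f0: "f 0 = 0" and f1: "f 1 > 1"
    using assms by (auto simp: f_def)
  have "\<exists>x\<ge>0. x \<le> 1 \<and> f x = 1"
    by (rule IVT') (use f0 f1 in \<open>auto simp: f_def power_0_left intro!: continuous_intros\<close>)
  then obtain x where x: "0 \<le> x" "x \<le> 1" "f x = 1" by blast
  have "x \<noteq> 0" "x \<noteq> 1" using x(3) f0 f1 by auto
  then have x': "0 < x" "x < 1" using x by auto
  have "\<exists>!r. 0 < r \<and> r < 1 \<and> f r = 1"
  proof (rule ex1I[of _ x])
    show "0 < x \<and> x < 1 \<and> f x = 1" using x' x(3) by simp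
    show "y = x" if "0 < y \<and> y < 1 \<and> f y = 1" for y
      using that x' x(3) less[of x y] less[of y x] by (cases x y rule: linorder_cases) auto
  qed
  then show ?thesis by (simp add: f_def)
qed

lemma r_of_props:
  assumes "n \<ge> 1"
  shows "0 < r_of n" "r_of n < 1" "r_of n ^ n * (1 + real n * (1 + r_of n)) = 1"
  using theI'[OF r_of_ex1[OF assms]] by (simp_all add: r_of_def)

definition h_of :: "nat \<Rightarrow> real" where
  "h_of n = 1 + r_of n"

definition alpha_of :: "nat \<Rightarrow> real" where
  "alpha_of n = 1 - r_of n"

definition sigma_wt :: "nat \<Rightarrow> nat \<Rightarrow> nat \<Rightarrow> real" where
  "sigma_wt n s t = (real s + 1) * real t * (alpha_of n + h_of n / 2 * (real t - real s - 1))"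

text \<open>The index of \<open>Z_seq\<close>, \<open>Y_seq\<close> and \<open>W_seq\<close> is an integer because the third difference
  \<open>W_seq\<close> refers to \<open>Y_seq\<close> at negative indices.\<close>

definition Z_seq :: "nat \<Rightarrow> int \<Rightarrow> real" where
  "Z_seq n i = (2 * h_of n * of_int i + 3 + r_of n - alpha_of n * r_of n powi (- 2 * i - 2)) / (h_of n)\<^sup>2"

definition Y_seq :: "nat \<Rightarrow> int \<Rightarrow> real" where
  "Y_seq n j = (if j < 0 then 0 else Z_seq n j / (real n - of_int j))"

definition W_seq :: "nat \<Rightarrow> int \<Rightarrow> real" where
  "W_seq n i = Y_seq n i - 3 * Y_seq n (i - 1) + 3 * Y_seq n (i - 2) - Y_seq n (i - 3)"

text \<open>The recursion for the suffix weights; only its values at \<open>i \<le> n - 2\<close> are used.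
  At \<open>i = 0\<close> the term with \<open>p\<^sub>-\<^sub>1 = 0\<close> is dropped.\<close>

primrec p_rec :: "nat \<Rightarrow> nat \<Rightarrow> real" where
  "p_rec n 0 = W_seq n 0 / (real n - 1)"
| "p_rec n (Suc i) =
     (W_seq n (int (Suc i)) + (real n - real (Suc i) + 4) * p_rec n i) / (real n - real (Suc i) - 1)"

text \<open>Suffix weights \<open>p\<^sub>a\<close> for \<open>0 \<le> a \<le> n - 1\<close>, with the last one given by its own formula.\<close>

definition suffix_wt :: "nat \<Rightarrow> nat \<Rightarrow> real" where
  "suffix_wt n a =
     (if a + 1 = n
      then 1 / alpha_of n *
        (real n - (\<Sum>b<n - 1. p_rec n b * (real n - real b) *
           (alpha_of n - h_of n / 2 * (real n - 1 - real b))))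
      else p_rec n a)"

text \<open>Adjacent weights \<open>q\<^sub>i\<close>, meaningful for \<open>0 \<le> i \<le> n - 2\<close>; in that range the natural-number
  subtractions are exact.\<close>

definition adjacent_wt :: "nat \<Rightarrow> nat \<Rightarrow> real" where
  "adjacent_wt n i = 1 / alpha_of n *
     (real i + 1 - (\<Sum>a\<le>i. suffix_wt n a * sigma_wt n (i - a) (n - i)))"

end

theory Submission
  imports Defs
begin

text \<open>The sums \<open>Z\<^sub>0 + \<dots> + Z\<^sub>j\<^sub>-\<^sub>1\<close> telescope to
  \<open>F(j) = ((1 + h j)\<^sup>2 - r powi (-2 j)) / h\<^sup>3\<close>, which vanishes at \<open>-1, 0, n\<close>, and solving the
  recursion gives \<open>p\<^sub>i\<close> as the third backward difference at \<open>i + 1\<close> of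
  \<open>G(j) = F(j) / ((n - j) (n - j + 1))\<close>. Being a quadratic interpolation error of an exponential, \<open>F\<close>
  is \<open>j (j + 1) (n - j)\<close> times a power series in \<open>j + 1\<close> with positive coefficients, so \<open>G\<close> is a
  product of absolutely monotone sequences and its third differences are positive.

  Summation by parts turns \<open>q\<^sub>i\<close> into an expression in \<open>F(i)\<close> and \<open>F(i + 1)\<close>. With \<open>k = i + 1\<close>
  it collapses to a positive multiple of
  \<open>r powi (-2 k) (2 + h (n - k))\<^sup>2 - (2 + h (n + k))\<^sup>2\<close>. This is zero at \<open>k = 0\<close> and
  \<open>k = n\<close>, and it is positive in between because \<open>artanh\<close> is strictly convex on \<open>[0, 1)\<close>. The last
  suffix weight becomes a polynomial in \<open>r\<close> and \<open>1 + n h\<close>.\<close>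

section \<open>Absolutely monotone sequences\<close>

text \<open>The range \<open>y < N\<close> is part of the notion because
  \<open>1 / (c - real y)\<close> is positive only before its pole. Differencing loses the last
  point, hence \<open>N - 1\<close>.\<close>

primrec abs_mono :: "nat \<Rightarrow> nat \<Rightarrow> (nat \<Rightarrow> real) \<Rightarrow> bool" where
  "abs_mono 0 N f = (\<forall>y<N. 0 \<le> f y)"
| "abs_mono (Suc l) N f = ((\<forall>y<N. 0 \<le> f y) \<and> abs_mono l (N - 1) (\<lambda>y. f (Suc y) - f y))"

lemma abs_mono_cong:
  assumes "abs_mono l N f" "\<And>y. y < N \<Longrightarrow> f y = g y"
  shows "abs_mono l N g"
  using assms
proof (induction l arbitrary: N f g)
  case 0
  then show ?case unfolding abs_mono.simps by metis
next
  case (Suc l)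
  have "abs_mono l (N - 1) (\<lambda>y. g (Suc y) - g y)"
  proof (rule Suc.IH)
    show "abs_mono l (N - 1) (\<lambda>y. f (Suc y) - f y)"
      using Suc.prems(1) unfolding abs_mono.simps by blast
    show "f (Suc y) - f y = g (Suc y) - g y" if "y < N - 1" for y
    proof -
      have "Suc y < N" "y < N" using that by linarith+
      then show ?thesis by (simp only: Suc.prems(2))
    qed
  qed
  moreover have "\<forall>y<N. 0 \<le> g y"
    using Suc.prems unfolding abs_mono.simps by metis
  ultimately show ?case unfolding abs_mono.simps by blast
qed

lemma abs_mono_nonneg: "abs_mono l N f \<Longrightarrow> y < N \<Longrightarrow> 0 \<le> f y"
  by (cases l) auto

lemma abs_mono_weaken: "abs_mono (Suc l) N f \<Longrightarrow> abs_mono l N f"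
proof (induction l arbitrary: N f)
  case (Suc l)
  have "abs_mono l (N - 1) (\<lambda>y. f (Suc y) - f y)"
    using Suc.prems by (intro Suc.IH) (unfold abs_mono.simps, blast)
  then show ?case using Suc.prems unfolding abs_mono.simps by blast
qed (unfold abs_mono.simps, blast)

lemma abs_mono_fewer: "abs_mono l N f \<Longrightarrow> N' \<le> N \<Longrightarrow> abs_mono l N' f"
proof (induction l arbitrary: N N' f)
  case 0
  then show ?case unfolding abs_mono.simps by (meson less_le_trans)
next
  case (Suc l)
  have "abs_mono l (N' - 1) (\<lambda>y. f (Suc y) - f y)"
    using Suc.prems unfolding abs_mono.simps by (blast intro: Suc.IH diff_le_mono)
  then show ?case using Suc.prems unfolding abs_mono.simps by (meson less_le_trans)
qed

lemma abs_mono_add: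
  "abs_mono l N f \<Longrightarrow> abs_mono l N g \<Longrightarrow> abs_mono l N (\<lambda>y. f y + g y)"
proof (induction l arbitrary: N f g)
  case 0
  then show ?case unfolding abs_mono.simps by (meson add_nonneg_nonneg)
next
  case (Suc l)
  have "abs_mono l (N - 1) (\<lambda>y. (f (Suc y) - f y) + (g (Suc y) - g y))"
    using Suc.prems by (intro Suc.IH) (unfold abs_mono.simps, blast+)
  then have "abs_mono l (N - 1) (\<lambda>y. f (Suc y) + g (Suc y) - (f y + g y))"
    by (rule abs_mono_cong) simp
  then show ?case
    using Suc.prems unfolding abs_mono.simps by (meson add_nonneg_nonneg)
qed

lemma abs_mono_shift:
  "abs_mono l N f \<Longrightarrow> abs_mono l (N - 1) (\<lambda>y. f (Suc y))"
proof (induction l arbitrary: N f)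
  case 0
  then show ?case by auto
next
  case (Suc l)
  have "\<forall>y<N - 1. 0 \<le> f (Suc y)"
    using Suc.prems by auto
  moreover have "abs_mono l (N - 1 - 1) (\<lambda>y. f (Suc (Suc y)) - f (Suc y))"
    using Suc.prems Suc.IH[of "N - 1" "\<lambda>y. f (Suc y) - f y"] unfolding abs_mono.simps by blast
  ultimately show ?case unfolding abs_mono.simps by blast
qed

text \<open>Discrete Leibniz rule: the difference of a product is the difference of \<open>f\<close>
  times \<open>g\<close> plus the shifted \<open>f\<close> times the difference of \<open>g\<close>.
  Both products have one order less, so induction applies.\<close>

lemma abs_mono_mult:
  "abs_mono l N f \<Longrightarrow> abs_mono l N g \<Longrightarrow> abs_mono l N (\<lambda>y. f y * g y)"
proof (induction l arbitrary: N f g)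
  case (Suc l)
  have "abs_mono l (N - 1) (\<lambda>y. (f (Suc y) - f y) * g y)"
    using Suc.prems(1) abs_mono_fewer[OF abs_mono_weaken[OF Suc.prems(2)]]
    by (intro Suc.IH) auto
  moreover have "abs_mono l (N - 1) (\<lambda>y. f (Suc y) * (g (Suc y) - g y))"
    using Suc.prems(2) abs_mono_shift[OF abs_mono_weaken[OF Suc.prems(1)]]
    by (intro Suc.IH) auto
  ultimately have "abs_mono l (N - 1)
      (\<lambda>y. (f (Suc y) - f y) * g y + f (Suc y) * (g (Suc y) - g y))"
    by (rule abs_mono_add)
  then have "abs_mono l (N - 1) (\<lambda>y. f (Suc y) * g (Suc y) - f y * g y)"
    by (rule abs_mono_cong) (simp add: algebra_simps)
  moreover have "\<forall>y<N. 0 \<le> f y * g y"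
    using Suc.prems by simp
  ultimately show ?case unfolding abs_mono.simps by blast
next
  case 0
  then show ?case unfolding abs_mono.simps by (meson mult_nonneg_nonneg)
qed

lemma abs_mono_const: "0 \<le> c \<Longrightarrow> abs_mono l N (\<lambda>_. c)"
proof (induction l arbitrary: N c)
  case (Suc l)
  then show ?case using Suc.IH[of 0] by simp
qed simp

lemma abs_mono_of_nat: "abs_mono l N real"
proof (cases l)
  case (Suc l')
  then show ?thesis using abs_mono_const[of 1 l' "N - 1"] by simp
qed simp

lemma abs_mono_falling2: "abs_mono l N (\<lambda>y. real y * (real y - 1))"
proof -
  have nonneg: "0 \<le> real y * (real y - 1)" for y by (cases y) auto
  show ?thesis
  proof (cases l)
    case (Suc l')
    have "abs_mono l' (N - 1) (\<lambda>y. 2 * real y)"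
      by (intro abs_mono_mult abs_mono_const abs_mono_of_nat) simp
    then have "abs_mono l' (N - 1) (\<lambda>y. real (Suc y) * (real (Suc y) - 1) - real y * (real y - 1))"
      by (rule abs_mono_cong) (simp add: algebra_simps)
    then show ?thesis
      unfolding Suc abs_mono.simps using nonneg by blast
  qed (use nonneg in \<open>simp only: abs_mono.simps, blast\<close>)
qed

text \<open>The first difference is the product of the reciprocals for \<open>c\<close> and
  \<open>c - 1\<close>, both covered by the induction hypothesis on \<open>N - 1\<close> points. An
  empty range is treated apart, since there \<open>N - 1\<close> is truncated.\<close>

lemma abs_mono_recip:
  "real N < c + 1 \<Longrightarrow> abs_mono l N (\<lambda>y. 1 / (c - real y))"
proof (induction l arbitrary: N c)
  case (Suc l)
  have "abs_mono l (N - 1) (\<lambda>y. 1 / (c - real y) * (1 / ((c - 1) - real y)))"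
    if "N > 0"
    by (intro abs_mono_mult Suc.IH) (use Suc.prems that in auto)
  then have "abs_mono l (N - 1) (\<lambda>y. 1 / (c - real (Suc y)) - 1 / (c - real y))" if "N > 0"
    by (rule abs_mono_cong) (use that Suc.prems in \<open>auto simp: field_simps\<close>)
  moreover have "abs_mono l 0 f" for f by (induction l arbitrary: f) auto
  ultimately have "abs_mono l (N - 1) (\<lambda>y. 1 / (c - real (Suc y)) - 1 / (c - real y))"
    by (cases "N > 0") auto
  moreover have "0 \<le> 1 / (c - real y)" if "y < N" for y
    using Suc.prems that by simp
  ultimately show ?case unfolding abs_mono.simps by blast
qed simp

definition third_diff :: "(nat \<Rightarrow> real) \<Rightarrow> nat \<Rightarrow> real" where
  "third_diff f y = f (y + 3) - 3 * f (y + 2) + 3 * f (y + 1) - f y"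

lemma abs_mono_third_diff:
  assumes "abs_mono 3 N f" "y + 3 < N"
  shows "0 \<le> third_diff f y"
  using assms by (auto simp: third_diff_def numeral_3_eq_3 algebra_simps)

text \<open>Absolute monotonicity gives only nonnegativity; this supplies strictness for the leading
  term of the expansion of \<open>G\<close>. Division by \<open>u = c - y\<close> leaves
  \<open>c * (c - 1) / u\<close> minus a linear function, which third differences
  annihilate.\<close>

lemma third_diff_recip:
  assumes "1 < c" "real y + 3 < c"
  shows "0 < third_diff (\<lambda>y. real y * (real y - 1) * (1 / (c - real y))) y"
proof -
  define t where "t = c - real y - 3"
  have t: "0 < t" using assms by (simp add: t_def)
  have e: "(c - u) * (c - u - 1) * (1 / (c - (c - u))) = c * (c - 1) * (1 / u) - (2 * c - u - 1)"
    if "0 < u" for u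
  proof -
    have "(c - u) * (c - u - 1) = c * (c - 1) - (2 * c - u - 1) * u" by algebra
    then show ?thesis using that by (simp add: diff_divide_distrib)
  qed
  have "third_diff (\<lambda>y. real y * (real y - 1) * (1 / (c - real y))) y
      = c * (c - 1) * (1 / t - 3 * (1 / (t + 1)) + 3 * (1 / (t + 2)) - 1 / (t + 3))"
  proof -
    have y: "real y = c - (t + 3)" "real (y + 1) = c - (t + 2)" "real (y + 2) = c - (t + 1)"
      "real (y + 3) = c - t" by (simp_all add: t_def)
    have "0 < t + 1" "0 < t + 2" "0 < t + 3" using t by auto
    then show ?thesis
      unfolding third_diff_def y using t by (simp only: e) algebra
  qed
  also have "1 / t - 3 * (1 / (t + 1)) + 3 * (1 / (t + 2)) - 1 / (t + 3)
      = 6 / (t * (t + 1) * (t + 2) * (t + 3))"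
    using t by (simp add: divide_simps) (simp add: algebra_simps)
  finally show ?thesis using assms t by simp
qed

lemma sums_pos:
  fixes f :: "nat \<Rightarrow> real"
  assumes "f sums s" "\<And>j. 0 \<le> f j" "0 < f 0"
  shows "0 < s"
  using suminf_pos2[of f 0] assms by (auto simp: sums_iff)

section \<open>Interpolation errors of powers\<close>

text \<open>\<^term>\<open>hom_sum m j y\<close> is the complete homogeneous polynomial of degree \<open>j\<close> in
  \<open>0, 1, m, y\<close>, that is, the divided difference of \<open>x ^ (j + 3)\<close> at these four points.\<close>

primrec hom_sum :: "real \<Rightarrow> nat \<Rightarrow> real \<Rightarrow> real" where
  "hom_sum m 0 y = 1"
| "hom_sum m (Suc j) y = (\<Sum>a\<le>Suc j. m ^ a) + y * hom_sum m j y"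

text \<open>Newton's error formula: the first two terms on the right form the quadratic agreeing
  with \<open>y ^ (j + 3)\<close> at \<open>0\<close>, \<open>1\<close> and
  \<open>m\<close>.\<close>

lemma hom_sum_interpolation:
  "y * (y - 1) * (m - y) * hom_sum m j y
     = y + y * (y - 1) * (\<Sum>a\<le>Suc j. m ^ a) - y ^ (j + 3)"
proof (induction j)
  case 0
  show ?case by (simp add: eval_nat_numeral algebra_simps)
next
  case (Suc j)
  let ?u = "\<Sum>a\<le>Suc j. m ^ a"
  have u: "(\<Sum>a\<le>Suc (Suc j). m ^ a) = 1 + m * ?u"
    by (subst sum.atMost_Suc_shift) (simp add: sum_distrib_left algebra_simps)
  have "y * (y - 1) * (m - y) * hom_sum m (Suc j) y
      = y * (y - 1) * (m - y) * ?u + y * (y * (y - 1) * (m - y) * hom_sum m j y)"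
    unfolding hom_sum.simps by (simp only: algebra_simps)
  also have "\<dots> = y * (y - 1) * (m - y) * ?u + y * (y + y * (y - 1) * ?u - y ^ (j + 3))"
    by (simp only: Suc)
  also have "\<dots> = y + y * (y - 1) * (1 + m * ?u) - y ^ (Suc j + 3)"
    by (simp only: power_Suc add_Suc) algebra
  finally show ?case by (simp only: u)
qed

lemma abs_mono_hom_sum: "0 \<le> m \<Longrightarrow> abs_mono l N (\<lambda>y. hom_sum m j (real y))"
proof (induction j)
  case (Suc j)
  then show ?case
    unfolding hom_sum.simps
    by (intro abs_mono_add abs_mono_mult abs_mono_const abs_mono_of_nat sum_nonneg) auto
qed (auto intro: abs_mono_const)

lemma exp_tail_sums:
  fixes L z :: real
  shows "(\<lambda>j. L ^ (j + 3) / fact (j + 3) * z ^ (j + 3)) sums (exp (L * z) - 1 - L * z - (L * z)\<^sup>2 / 2)"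
proof -
  have "(\<lambda>k. (L * z) ^ k /\<^sub>R fact k) sums exp (L * z)"
    by (rule exp_converges)
  then have "(\<lambda>j. (L * z) ^ (j + 3) /\<^sub>R fact (j + 3)) sums
      (exp (L * z) - (\<Sum>k<3. (L * z) ^ k /\<^sub>R fact k))"
    by (subst sums_iff_shift) simp
  moreover have "(\<Sum>k<3. (L * z) ^ k /\<^sub>R fact k) = 1 + L * z + (L * z)\<^sup>2 / 2"
    by (simp add: eval_nat_numeral)
  moreover have "(\<lambda>j. (L * z) ^ (j + 3) /\<^sub>R fact (j + 3))
      = (\<lambda>j. L ^ (j + 3) / fact (j + 3) * z ^ (j + 3))"
    unfolding power_mult_distrib by (simp add: divide_inverse mult_ac)
  ultimately show ?thesis
    by (simp only: diff_diff_eq)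
qed

text \<open>The limit is the quadratic interpolating \<open>exp (L x)\<close> at \<open>0, 1, m\<close>, minus \<open>exp (L x)\<close>, at
  \<open>x = y\<close>; the series starts at \<open>L\<^sup>3\<close> because lower powers are interpolated exactly.\<close>

lemma exp_interpolation_sums:
  fixes L m y :: real
  assumes m: "m \<noteq> 0" "m \<noteq> 1"
  shows "(\<lambda>j. L ^ (j + 3) / fact (j + 3) * (y * (y - 1) * (m - y) * hom_sum m j y)) sums
    (1 + (exp L - 1) * y + y * (y - 1) * ((exp (L * m) - 1) / m - (exp L - 1)) / (m - 1) - exp (L * y))"
proof -
  define R where "R z = exp (L * z) - 1 - L * z - (L * z)\<^sup>2 / 2" for z
  define c where "c j = L ^ (j + 3) / fact (j + 3)" for j
  have R: "(\<lambda>j. c j * z ^ (j + 3)) sums R z" for z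
    unfolding c_def R_def by (rule exp_tail_sums)
  \<comment> \<open>\<open>y - A\<close> and \<open>A / m\<close> are the Lagrange weights at
    \<open>y\<close> of the nodes \<open>1\<close> and \<open>m\<close>; the node \<open>0\<close>
    contributes nothing, as \<open>x ^ (j + 3)\<close> vanishes there.\<close>
  define A where "A = y * (y - 1) / (m - 1)"
  have A: "A * (m - 1) = y * (y - 1)" using m by (simp add: A_def)
  have "(\<lambda>j. c j * 1 ^ (j + 3) * (y - A) + c j * m ^ (j + 3) * (A / m) - c j * y ^ (j + 3))
      sums (R 1 * (y - A) + R m * (A / m) - R y)"
    by (intro sums_add sums_diff sums_mult2 R)
  moreover have "c j * (y * (y - 1) * (m - y) * hom_sum m j y)
      = c j * 1 ^ (j + 3) * (y - A) + c j * m ^ (j + 3) * (A / m) - c j * y ^ (j + 3)" for j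
  proof -
    have "(m - 1) * (\<Sum>a\<le>Suc j. m ^ a) = m ^ (j + 2) - 1"
      using power_diff_1_eq[of m "j + 2"] by (simp add: lessThan_Suc_atMost)
    then have "y * (y - 1) * (\<Sum>a\<le>Suc j. m ^ a) = A * (m ^ (j + 2) - 1)"
      by (simp only: A[symmetric] mult.assoc)
    then have e1: "y * (y - 1) * (m - y) * hom_sum m j y = y + A * (m ^ (j + 2) - 1) - y ^ (j + 3)"
      by (simp only: hom_sum_interpolation)
    have e2: "m ^ (j + 3) * (A / m) = A * m ^ (j + 2)"
      using m by (simp add: power_add eval_nat_numeral)
    show ?thesis
      by (simp only: e1 mult.assoc[of "c j" "m ^ (j + 3)"] e2) (simp add: algebra_simps)
  qed
  moreover have "R 1 * (y - A) + R m * (A / m) - R y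
     = 1 + (exp L - 1) * y + y * (y - 1) * ((exp (L * m) - 1) / m - (exp L - 1)) / (m - 1) - exp (L * y)"
  proof -
    have "R m * (A / m) = ((exp (L * m) - 1) / m - L - L\<^sup>2 / 2 * m) * A"
      using m by (simp add: R_def field_simps power2_eq_square)
    moreover have "y * (y - 1) * ((exp (L * m) - 1) / m - (exp L - 1)) / (m - 1)
        = A * ((exp (L * m) - 1) / m - (exp L - 1))"
      by (simp add: A_def)
    moreover have "(exp L - 1 - L - L\<^sup>2 / 2) * (y - A) + (t - L - L\<^sup>2 / 2 * m) * A - (e - 1 - L * y - (L * y)\<^sup>2 / 2)
       = 1 + (exp L - 1) * y + A * (t - (exp L - 1)) - e" for t e
      using A by algebra
    ultimately show ?thesis by (simp add: R_def)
  qed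
  ultimately show ?thesis by (simp add: c_def)
qed

section \<open>Closed form of the weights\<close>

definition back_diff3 :: "(int \<Rightarrow> real) \<Rightarrow> int \<Rightarrow> real" where
  "back_diff3 g j = g j - 3 * g (j - 1) + 3 * g (j - 2) - g (j - 3)"

text \<open>Weights \<open>1\<close>, \<open>k\<close> and \<open>k\<close> squared have generating
  functions \<open>1/(1-x)\<close>, \<open>x/(1-x)^2\<close> and \<open>x(1+x)/(1-x)^3\<close>.
  Against the factor \<open>(1-x)^3\<close> of a third difference they leave a second difference, a
  first difference and a sum of two neighbours. Vanishing of \<open>g\<close> at nonpositive
  arguments removes all boundary terms.\<close>

lemma sum_back_diff3:
  assumes "\<And>j. j \<le> 0 \<Longrightarrow> g j = 0"
  shows "(\<Sum>a\<le>i. back_diff3 g (int a + 1)) = g (int i + 1) - 2 * g (int i) + g (int i - 1)"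
  using assms by (induction i) (auto simp: back_diff3_def algebra_simps)

lemma sum_back_diff3_linear:
  assumes "\<And>j. j \<le> 0 \<Longrightarrow> g j = 0"
  shows "(\<Sum>a\<le>i. back_diff3 g (int a + 1) * (real i + 1 - real a)) = g (int i + 1) - g (int i)"
proof (induction i)
  case 0
  show ?case using assms by (simp add: back_diff3_def)
next
  case (Suc i)
  let ?p = "\<lambda>a. back_diff3 g (int a + 1)"
  have "(\<Sum>a\<le>Suc i. ?p a * (real (Suc i) + 1 - real a))
      = (\<Sum>a\<le>i. ?p a * (real i + 1 - real a) + ?p a) + ?p (Suc i)"
    by (simp add: algebra_simps)
  also have "\<dots> = (\<Sum>a\<le>i. ?p a * (real i + 1 - real a)) + (\<Sum>a\<le>Suc i. ?p a)"
    by (simp add: sum.distrib)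
  also have "\<dots> = g (int (Suc i) + 1) - g (int (Suc i))"
    unfolding Suc using sum_back_diff3[of g "Suc i"] assms by (simp add: add.commute)
  finally show ?case .
qed

lemma sum_back_diff3_square:
  assumes "\<And>j. j \<le> 0 \<Longrightarrow> g j = 0"
  shows "(\<Sum>a\<le>i. back_diff3 g (int a + 1) * (real i + 1 - real a)\<^sup>2) = g (int i + 1) + g (int i)"
proof (induction i)
  case 0
  show ?case using assms by (simp add: back_diff3_def)
next
  case (Suc i)
  let ?p = "\<lambda>a. back_diff3 g (int a + 1)"
  have "(\<Sum>a\<le>Suc i. ?p a * (real (Suc i) + 1 - real a)\<^sup>2)
      = (\<Sum>a\<le>i. ?p a * (real i + 1 - real a)\<^sup>2 + 2 * (?p a * (real i + 1 - real a)) + ?p a)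
        + ?p (Suc i)"
    by (simp add: algebra_simps power2_eq_square)
  also have "\<dots> = (\<Sum>a\<le>i. ?p a * (real i + 1 - real a)\<^sup>2)
        + 2 * (\<Sum>a\<le>i. ?p a * (real i + 1 - real a)) + (\<Sum>a\<le>Suc i. ?p a)"
    by (simp add: sum.distrib sum_distrib_left)
  also have "\<dots> = g (int (Suc i) + 1) + g (int (Suc i))"
    unfolding Suc using sum_back_diff3[of g "Suc i"] sum_back_diff3_linear[of g i] assms
    by (simp add: add.commute)
  finally show ?case .
qed

text \<open>Induction step for solving the recursion, with \<open>x = n - (i + 1)\<close> and
  \<open>a\<close> to \<open>e\<close> the values of \<open>F\<close> from \<open>i + 2\<close> down
  to \<open>i - 2\<close>. The factor \<open>x + 4\<close> is what makes the two contributions of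
  \<open>e\<close> cancel.\<close>

lemma suffix_recursion_identity:
  fixes x a b c d e :: real
  assumes "x > 1"
  shows "(((a - b) / x - 3 * ((b - c) / (x + 1)) + 3 * ((c - d) / (x + 2)) - (d - e) / (x + 3))
      + (x + 4) * (b / (x * (x + 1)) - 3 * (c / ((x + 1) * (x + 2)))
          + 3 * (d / ((x + 2) * (x + 3))) - e / ((x + 3) * (x + 4)))) / (x - 1)
    = a / ((x - 1) * x) - 3 * (b / (x * (x + 1))) + 3 * (c / ((x + 1) * (x + 2)))
      - d / ((x + 2) * (x + 3))"
  using assms by (simp add: divide_simps) algebra

text \<open>The function \<open>2 * artanh (x / c)\<close> is strictly convex on \<open>[0, c)\<close> and vanishes at \<open>0\<close>.\<close>

lemma ln_ratio_superlinear:
  fixes c x y :: real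
  assumes "0 < x" "x < y" "y < c"
  shows "y * (ln (c + x) - ln (c - x)) < x * (ln (c + y) - ln (c - y))"
proof -
  define f where "f t = ln (c + t) - ln (c - t)" for t
  define f' where "f' t = 1 / (c + t) + 1 / (c - t)" for t
  have d: "(f has_real_derivative f' t) (at t)" if "0 \<le> t" "t < c" for t
    unfolding f_def f'_def using that by (auto intro!: derivative_eq_intros)
  obtain s where s: "0 < s" "s < x" "f x - f 0 = (x - 0) * f' s"
    using MVT2[of 0 x f f'] d assms by auto
  obtain t where t: "x < t" "t < y" "f y - f x = (y - x) * f' t"
    using MVT2[of x y f f'] d assms by auto
  have f': "f' u = 2 * c / (c\<^sup>2 - u\<^sup>2)" if "0 \<le> u" "u < c" for u
  proof -
    have "c\<^sup>2 - u\<^sup>2 = (c + u) * (c - u)" by algebra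
    then show ?thesis using that by (simp add: f'_def divide_simps)
  qed
  have "f' s < f' t"
  proof -
    have "s\<^sup>2 < t\<^sup>2" "t\<^sup>2 < c\<^sup>2"
      using s t assms by (auto intro!: power_strict_mono)
    then have "2 * c / (c\<^sup>2 - s\<^sup>2) < 2 * c / (c\<^sup>2 - t\<^sup>2)"
      using s t assms by (intro divide_strict_left_mono) auto
    then show ?thesis using f' s t assms by auto
  qed
  then have "x * (y - x) * f' s < x * (y - x) * f' t"
    using assms by simp
  moreover have "f 0 = 0" by (simp add: f_def)
  ultimately have "(y - x) * f x < x * (f y - f x)"
    using s(3) t(3) by (simp add: mult_ac)
  then show ?thesis by (simp add: f_def algebra_simps)
qed

section \<open>Telescoping of \<open>Z_seq\<close> and solution of the suffix recursion\<close>

locale weights =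
  fixes n :: nat
  assumes n_pos: "1 \<le> n"
begin

abbreviation "r \<equiv> r_of n"
abbreviation "h \<equiv> h_of n"
abbreviation "\<alpha> \<equiv> alpha_of n"

lemma r_pos: "0 < r" and r_less_1: "r < 1" and r_root: "r ^ n * (1 + real n * (1 + r)) = 1"
  using r_of_props[OF n_pos] by auto

lemma h_eq: "h = 1 + r" and alpha_eq: "\<alpha> = 1 - r"
  by (simp_all add: h_of_def alpha_of_def)

lemma h_pos: "0 < h" and alpha_pos: "0 < \<alpha>"
  using r_pos r_less_1 by (auto simp: h_eq alpha_eq)

text \<open>The partial sums of \<^const>\<open>Z_seq\<close>; the formula vanishes at \<open>-1\<close>, \<open>0\<close> and \<open>n\<close>, but not
  at smaller integers.\<close>

definition F :: "int \<Rightarrow> real" where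
  "F j = (if j \<le> 0 then 0 else ((1 + h * of_int j)\<^sup>2 - r powi (- 2 * j)) / h ^ 3)"

definition G :: "int \<Rightarrow> real" where
  "G j = F j / ((real n - of_int j) * (real n - of_int j + 1))"

lemma G_nonpos: "j \<le> 0 \<Longrightarrow> G j = 0"
  by (simp add: G_def F_def)

lemma r_powi: "r powi (- int (2 * k)) = (1 / r\<^sup>2) ^ k"
proof -
  have "r powi (- int (2 * k)) = inverse (r ^ (2 * k))"
    by (simp only: power_int_minus power_int_of_nat)
  then show ?thesis
    by (simp only: power_mult power_inverse divide_inverse mult_1_left)
qed

lemma F_nat: "F (int k) = ((1 + h * real k)\<^sup>2 - (1 / r\<^sup>2) ^ k) / h ^ 3"
proof (cases "k = 0")
  case False
  have "- 2 * int k = - int (2 * k)" by simp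
  then show ?thesis using False by (simp only: F_def r_powi) simp
qed (simp add: F_def)

text \<open>\<open>Z_seq\<close> is the forward difference of \<open>F\<close>. Since
  \<open>F\<close> is set to \<open>0\<close> at nonpositive arguments, the convention for negative
  indices of \<open>Y_seq\<close> is reproduced as well.\<close>

lemma Y_seq_eq: "Y_seq n j = (F (j + 1) - F j) / (real n - of_int j)"
proof (cases "j < 0")
  case True
  then show ?thesis by (simp add: Y_seq_def F_def)
next
  case False
  then obtain k where k: "j = int k" by (metis nat_0_le not_less)
  have e: "r powi (- 2 * j - 2) = (1 / r\<^sup>2) ^ Suc k"
  proof -
    have "- 2 * j - 2 = - int (2 * Suc k)" by (simp add: k)
    then show ?thesis by (simp only: r_powi)
  qed
  define E where "E = (1 / r\<^sup>2) ^ Suc k"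
  have E: "(1 / r\<^sup>2) ^ k = r\<^sup>2 * E" using r_pos by (simp add: E_def)
  have "F (j + 1) - F j
      = ((1 + h * (real k + 1))\<^sup>2 - E - ((1 + h * real k)\<^sup>2 - r\<^sup>2 * E)) / h ^ 3"
  proof -
    have "j + 1 = int (Suc k)" "real k + 1 = real (Suc k)" by (simp_all add: k)
    then have "F (j + 1) = ((1 + h * (real k + 1))\<^sup>2 - E) / h ^ 3"
      by (simp only: F_nat E_def)
    moreover have "F j = ((1 + h * real k)\<^sup>2 - r\<^sup>2 * E) / h ^ 3"
      by (simp only: k F_nat E)
    ultimately show ?thesis by (simp only: diff_divide_distrib)
  qed
  also have "(1 + h * (real k + 1))\<^sup>2 - E - ((1 + h * real k)\<^sup>2 - r\<^sup>2 * E)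
      = h * (2 * h * real k + 3 + r - \<alpha> * E)"
    unfolding h_eq alpha_eq by algebra
  also have "\<dots> / h ^ 3 = Z_seq n j"
    unfolding Z_seq_def e E_def[symmetric]
    using h_pos by (simp add: k power2_eq_square power3_eq_cube)
  finally show ?thesis unfolding Y_seq_def using False by (simp only: if_False)
qed

lemma p_rec_eq: "i + 2 \<le> n \<Longrightarrow> p_rec n i = back_diff3 G (int i + 1)"
proof (induction i)
  case 0
  then show ?case
    by (simp add: W_seq_def Y_seq_eq back_diff3_def G_def F_def)
next
  case (Suc i)
  define x where "x = real n - real (Suc i)"
  have "x > 1" using Suc.prems by (simp add: x_def)
  note id = suffix_recursion_identity[OF this, of "F (int i + 2)" "F (int i + 1)" "F (int i)"
      "F (int i - 1)" "F (int i - 2)"]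
  have n: "real n = x + real i + 1" by (simp add: x_def)
  have G: "G (int i + 2) = F (int i + 2) / ((x - 1) * x)"
    "G (int i + 1) = F (int i + 1) / (x * (x + 1))"
    "G (int i) = F (int i) / ((x + 1) * (x + 2))"
    "G (int i - 1) = F (int i - 1) / ((x + 2) * (x + 3))"
    "G (int i - 2) = F (int i - 2) / ((x + 3) * (x + 4))"
    by (simp_all add: G_def n add.commute)
  have Y: "Y_seq n (int i + 1) = (F (int i + 2) - F (int i + 1)) / x"
    "Y_seq n (int i) = (F (int i + 1) - F (int i)) / (x + 1)"
    "Y_seq n (int i - 1) = (F (int i) - F (int i - 1)) / (x + 2)"
    "Y_seq n (int i - 2) = (F (int i - 1) - F (int i - 2)) / (x + 3)"
    by (simp_all add: Y_seq_eq n add.commute)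
  have "W_seq n (int (Suc i)) = Y_seq n (int i + 1) - 3 * Y_seq n (int i)
      + 3 * Y_seq n (int i - 1) - Y_seq n (int i - 2)"
    by (simp add: W_seq_def add.commute)
  moreover have "p_rec n i = G (int i + 1) - 3 * G (int i) + 3 * G (int i - 1) - G (int i - 2)"
    using Suc by (simp add: back_diff3_def)
  moreover have "p_rec n (Suc i) = (W_seq n (int (Suc i)) + (x + 4) * p_rec n i) / (x - 1)"
    by (simp only: p_rec.simps x_def)
  moreover have "back_diff3 G (int (Suc i) + 1)
      = G (int i + 2) - 3 * G (int i + 1) + 3 * G (int i) - G (int i - 1)"
    by (simp add: back_diff3_def add.commute)
  ultimately show ?case by (simp only: G Y id)
qed

section \<open>The suffix weights before the last\<close>

text \<open>The \<open>j\<close>-th term of the expansion of \<^const>\<open>G\<close>, up to a positive factor; the index is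
  shifted by one so that the zeros of \<^const>\<open>F\<close> are at \<open>0, 1, n + 1\<close>.\<close>

definition G_term :: "nat \<Rightarrow> nat \<Rightarrow> real" where
  "G_term j y = real y * (real y - 1) * (1 / (real n + 2 - real y)) * hom_sum (real n + 1) j (real y)"

text \<open>The interpolated function is \<open>exp (L * x)\<close> with
  \<open>L = - 2 * ln r\<close>, positive as \<open>r < 1\<close>. The square of \<open>r\<close>
  undoes the shift of the argument by one.\<close>

definition G_coeff :: "nat \<Rightarrow> real" where
  "G_coeff j = r\<^sup>2 / h ^ 3 * ((- 2 * ln r) ^ (j + 3) / fact (j + 3))"

lemma G_coeff_pos: "0 < G_coeff j"
proof -
  define L where "L = - 2 * ln r"
  have "0 < L" using r_pos r_less_1 by (simp add: L_def)
  then show ?thesis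
    unfolding G_coeff_def L_def[symmetric] using r_pos h_pos by simp
qed

lemma abs_mono_G_term: "abs_mono l (n + 1) (G_term j)"
  unfolding G_term_def
  by (intro abs_mono_mult abs_mono_falling2 abs_mono_recip abs_mono_hom_sum) auto

text \<open>The squared defining equation of \<open>r\<close>; it is what makes \<open>F\<close>
  vanish at \<open>n\<close>.\<close>

lemma root_square: "(1 / r\<^sup>2) ^ n = (1 + real n * h)\<^sup>2"
proof -
  have "(r ^ n)\<^sup>2 * (1 + real n * h)\<^sup>2 = 1"
    using r_root by (simp only: h_eq power_mult_distrib[symmetric] one_power2)
  then show ?thesis
    using r_pos by (simp add: power_one_over field_simps flip: power_mult)
qed

lemma F_interpolation_sums:
  "(\<lambda>j. G_coeff j * ((real k + 1) * real k * (real n - real k) * hom_sum (real n + 1) j (real k + 1)))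
     sums F (int k)"
proof -
  define L where "L = - 2 * ln r"
  define m where "m = real n + 1"
  have m: "m \<noteq> 0" "m \<noteq> 1" using n_pos by (auto simp: m_def)
  have expL: "exp (L * real j) = (1 / r\<^sup>2) ^ j" for j
  proof -
    have "exp L = 1 / r\<^sup>2"
      using r_pos by (simp add: L_def exp_minus exp_double divide_inverse)
    then show ?thesis by (simp only: mult.commute[of L] exp_of_nat_mult)
  qed
  define V where "V = 1 + (exp L - 1) * (real k + 1)
      + (real k + 1) * ((real k + 1) - 1) * ((exp (L * m) - 1) / m - (exp L - 1)) / (m - 1)
      - exp (L * (real k + 1))"
  have "(\<lambda>j. r\<^sup>2 / h ^ 3 * (L ^ (j + 3) / fact (j + 3)
      * ((real k + 1) * ((real k + 1) - 1) * (m - (real k + 1)) * hom_sum m j (real k + 1))))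
     sums (r\<^sup>2 / h ^ 3 * V)"
    unfolding V_def by (intro sums_mult exp_interpolation_sums m)
  moreover have "r\<^sup>2 / h ^ 3 * V = F (int k)"
  proof -
    have L1: "exp L = 1 / r\<^sup>2" using expL[of 1] by simp
    have Lm: "exp (L * m) = (1 / r\<^sup>2) * (1 + real n * h)\<^sup>2"
      using expL[of "n + 1"] root_square by (simp add: m_def add.commute)
    have Lk: "exp (L * (real k + 1)) = (1 / r\<^sup>2) * (1 / r\<^sup>2) ^ k"
      using expL[of "k + 1"] by (simp add: add.commute)
    define e where "e = 1 / r\<^sup>2"
    have e: "e * r\<^sup>2 = 1" using r_pos by (simp add: e_def)
    \<comment> \<open>The second divided difference of the exponential at \<open>0, 1, m\<close> is
      the leading coefficient of the interpolating quadratic, here \<open>(1 + h (x - 1))\<close>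
      squared times \<open>e\<close>.\<close>
    have "e * (1 + real n * h)\<^sup>2 - 1 = m * ((e - 1) + (m - 1) * (h\<^sup>2 * e))"
      using e unfolding m_def h_eq by algebra
    then have q: "((e * (1 + real n * h)\<^sup>2 - 1) / m - (e - 1)) / (m - 1) = h\<^sup>2 * e"
      using m by simp
    have "V = 1 + (e - 1) * (real k + 1) + (real k + 1) * real k * (h\<^sup>2 * e) - e * e ^ k"
      unfolding V_def L1 Lm Lk e_def[symmetric] times_divide_eq_right[symmetric] q by simp
    moreover have "r\<^sup>2 * (1 + (e - 1) * (real k + 1) + (real k + 1) * real k * (h\<^sup>2 * e) - e * p)
        = (1 + h * real k)\<^sup>2 - p" for p
      using e unfolding h_eq by algebra
    ultimately have "r\<^sup>2 * V = (1 + h * real k)\<^sup>2 - e ^ k"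
      by (simp only:)
    then show ?thesis by (simp add: F_nat e_def)
  qed
  ultimately show ?thesis
    by (simp add: G_coeff_def L_def m_def mult.assoc)
qed

text \<open>The factor \<open>n - k\<close> of the expansion of \<open>F\<close> cancels one
  denominator of \<open>G\<close>; the other has its pole at \<open>n + 2\<close>, beyond the range.
  At \<open>y = 0\<close> both sides vanish.\<close>

lemma G_sums:
  assumes "y \<le> n"
  shows "(\<lambda>j. G_coeff j * G_term j y) sums G (int y - 1)"
proof (cases y)
  case 0
  then show ?thesis by (simp add: G_term_def G_nonpos)
next
  case (Suc k)
  define d where "d = real n - real k"
  have d: "0 < d" using assms Suc by (simp add: d_def)
  have "(\<lambda>j. G_coeff j * ((real k + 1) * real k * d * hom_sum (real n + 1) j (real k + 1))
      * (1 / (d * (d + 1)))) sums (F (int k) * (1 / (d * (d + 1))))"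
    unfolding d_def by (rule sums_mult2[OF F_interpolation_sums])
  moreover have "G (int y - 1) = F (int k) * (1 / (d * (d + 1)))"
    by (simp add: Suc G_def d_def)
  moreover have "G_coeff j * ((real k + 1) * real k * d * hom_sum (real n + 1) j (real k + 1))
      * (1 / (d * (d + 1))) = G_coeff j * G_term j y" for j
  proof -
    have "real n + 2 - real y = d + 1" "real y = real k + 1" "real y - 1 = real k"
      by (simp_all add: Suc d_def)
    then show ?thesis unfolding G_term_def by (simp only:) (use d in simp)
  qed
  ultimately show ?thesis by simp
qed

lemma p_rec_pos:
  assumes "i + 2 \<le> n"
  shows "0 < p_rec n i"
proof (cases i)
  case 0
  \<comment> \<open>For \<open>i = 0\<close> the third difference would reach the shifted index
    \<open>-1\<close>, outside the expansion; but all its values except \<open>G 1\<close> are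
    zero.\<close>
  have "(\<lambda>j. G_coeff j * G_term j 2) sums G (int 2 - 1)"
    using assms by (intro G_sums) simp
  moreover have "0 \<le> G_coeff j * G_term j 2" for j
    using abs_mono_nonneg[OF abs_mono_G_term] G_coeff_pos[of j] assms by simp
  moreover have "0 < G_coeff 0 * G_term 0 2"
    using G_coeff_pos[of 0] assms n_pos by (simp add: G_term_def)
  ultimately have "0 < G 1" using sums_pos by fastforce
  then show ?thesis
    using p_rec_eq[OF assms] 0 by (simp add: back_diff3_def G_nonpos)
next
  case (Suc k)
  have k: "k + 3 \<le> n" using assms Suc by simp
  have "(\<lambda>j. G_coeff j * G_term j (k + 3) - 3 * (G_coeff j * G_term j (k + 2))
        + 3 * (G_coeff j * G_term j (k + 1)) - G_coeff j * G_term j k)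
      sums (G (int (k + 3) - 1) - 3 * G (int (k + 2) - 1) + 3 * G (int (k + 1) - 1) - G (int k - 1))"
    using k by (intro sums_add sums_diff sums_mult G_sums) auto
  moreover have "G (int (k + 3) - 1) - 3 * G (int (k + 2) - 1) + 3 * G (int (k + 1) - 1) - G (int k - 1)
      = p_rec n i"
    using p_rec_eq[OF assms] Suc by (simp add: back_diff3_def add.commute)
  moreover have "G_coeff j * G_term j (k + 3) - 3 * (G_coeff j * G_term j (k + 2))
        + 3 * (G_coeff j * G_term j (k + 1)) - G_coeff j * G_term j k
      = G_coeff j * third_diff (G_term j) k" for j
    unfolding third_diff_def by algebra
  ultimately have "(\<lambda>j. G_coeff j * third_diff (G_term j) k) sums p_rec n i"
    by (simp only:)
  moreover have "0 \<le> G_coeff j * third_diff (G_term j) k" for j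
    using abs_mono_third_diff[OF abs_mono_G_term] k G_coeff_pos[of j] by simp
  moreover have "0 < G_coeff 0 * third_diff (G_term 0) k"
  proof -
    have "G_term 0 = (\<lambda>y. real y * (real y - 1) * (1 / (real n + 2 - real y)))"
      by (simp add: G_term_def fun_eq_iff)
    then show ?thesis
      using third_diff_recip[of "real n + 2" k] k G_coeff_pos[of 0] by simp
  qed
  ultimately show ?thesis by (rule sums_pos)
qed

section \<open>The adjacent weights\<close>

lemma sum_p_rec:
  assumes "i + 2 \<le> n"
  shows "(\<Sum>a\<le>i. p_rec n a) = G (int i + 1) - 2 * G (int i) + G (int i - 1)"
    and "(\<Sum>a\<le>i. p_rec n a * (real i + 1 - real a)) = G (int i + 1) - G (int i)"
    and "(\<Sum>a\<le>i. p_rec n a * (real i + 1 - real a)\<^sup>2) = G (int i + 1) + G (int i)"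
proof -
  have eq: "(\<Sum>a\<le>i. p_rec n a * w a) = (\<Sum>a\<le>i. back_diff3 G (int a + 1) * w a)" for w
    using assms by (intro sum.cong) (auto simp: p_rec_eq)
  show "(\<Sum>a\<le>i. p_rec n a) = G (int i + 1) - 2 * G (int i) + G (int i - 1)"
    using eq[of "\<lambda>_. 1"] sum_back_diff3[of G i] G_nonpos by simp
  show "(\<Sum>a\<le>i. p_rec n a * (real i + 1 - real a)) = G (int i + 1) - G (int i)"
    unfolding eq by (rule sum_back_diff3_linear) (rule G_nonpos)
  show "(\<Sum>a\<le>i. p_rec n a * (real i + 1 - real a)\<^sup>2) = G (int i + 1) + G (int i)"
    unfolding eq by (rule sum_back_diff3_square) (rule G_nonpos)
qed

text \<open>In terms of \<open>i + 1 - a\<close> the weight \<open>sigma_wt\<close> is a quadratic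
  without constant term, so the linear and square sums of \<open>p_rec\<close> express everything
  through \<open>F\<close> at \<open>i + 1\<close> and \<open>i\<close>.\<close>

lemma adjacent_wt_eq:
  assumes "i + 2 \<le> n"
  defines "k \<equiv> real i + 1" and "d \<equiv> real n - real i - 1"
  shows "adjacent_wt n i
    = ((1 / r\<^sup>2) ^ (i + 1) * (2 + h * d)\<^sup>2 - (2 + h * (real n + k))\<^sup>2) / (2 * h ^ 3 * d * (d + 2))"
proof -
  have d: "0 < d" using assms by simp
  have n: "real n = k + d" by (simp add: k_def d_def)
  define E where "E = (1 / r\<^sup>2) ^ (i + 1)"
  define A B where "A = F (int i + 1)" and "B = F (int i)"
  have "(\<Sum>a\<le>i. suffix_wt n a * sigma_wt n (i - a) (n - i))
      = (\<Sum>a\<le>i. (d + 1) * ((\<alpha> + h / 2 * (d + 1)) * (p_rec n a * (real i + 1 - real a))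
                 - h / 2 * (p_rec n a * (real i + 1 - real a)\<^sup>2)))"
  proof (rule sum.cong[OF refl])
    fix a assume a: "a \<in> {..i}"
    have p: "suffix_wt n a = p_rec n a" using a assms(1) by (simp add: suffix_wt_def)
    have st: "real (i - a) = real i - real a" "real (n - i) = d + 1"
      using a assms(1) by (auto simp: d_def)
    show "suffix_wt n a * sigma_wt n (i - a) (n - i)
        = (d + 1) * ((\<alpha> + h / 2 * (d + 1)) * (p_rec n a * (real i + 1 - real a))
                 - h / 2 * (p_rec n a * (real i + 1 - real a)\<^sup>2))"
      unfolding sigma_wt_def p st by (simp add: field_simps power2_eq_square)
  qed
  also have "\<dots> = (d + 1) * ((\<alpha> + h / 2 * (d + 1)) * (G (int i + 1) - G (int i))
                 - h / 2 * (G (int i + 1) + G (int i)))"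
    by (simp only: sum_distrib_left[symmetric] sum_subtractf sum_p_rec[OF assms(1)])
  also have "\<dots> = (\<alpha> / d + h / 2) * A - (\<alpha> / (d + 2) + h / 2) * B"
  proof -
    have "G (int i + 1) = A / (d * (d + 1))" "G (int i) = B / ((d + 1) * (d + 2))"
      by (simp_all add: G_def A_def B_def d_def diff_diff_eq)
    then have AB: "A = G (int i + 1) * (d * (d + 1))" "B = G (int i) * ((d + 1) * (d + 2))"
      using d by simp_all
    show ?thesis unfolding AB using d by (simp add: divide_simps) (simp add: algebra_simps)
  qed
  finally have "adjacent_wt n i
      = 1 / \<alpha> * (k - ((\<alpha> / d + h / 2) * A - (\<alpha> / (d + 2) + h / 2) * B))"
    by (simp only: adjacent_wt_def k_def)
  also have "\<dots> = (k - h / 2 * (A - B)) / \<alpha> - A / d + B / (d + 2)"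
  proof -
    have "k - ((\<alpha> / d + h / 2) * A - (\<alpha> / (d + 2) + h / 2) * B)
        = (k - h / 2 * (A - B)) - \<alpha> * (A / d) + \<alpha> * (B / (d + 2))"
      by (simp add: algebra_simps diff_divide_distrib)
    moreover have "1 / \<alpha> * (u - \<alpha> * v + \<alpha> * w) = u / \<alpha> - v + w" for u v w
      using alpha_pos by (simp add: field_simps)
    ultimately show ?thesis by (simp only:)
  qed
  also have "A = ((1 + h * k)\<^sup>2 - E) / h ^ 3"
    using F_nat[of "i + 1"] by (simp add: A_def k_def E_def add.commute)
  also have "B = ((1 + h * (k - 1))\<^sup>2 - r\<^sup>2 * E) / h ^ 3"
    using F_nat[of i] r_pos by (simp add: B_def k_def E_def)
  \<comment> \<open>The first difference \<open>A - B\<close> equals \<open>2 * k / h\<close> minus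
    a multiple of \<alpha>, so \<open>k\<close> drops out and the division by \<alpha> is
    exact.\<close>
  also have "(k - h / 2 * (((1 + h * k)\<^sup>2 - E) / h ^ 3 - ((1 + h * (k - 1))\<^sup>2 - r\<^sup>2 * E) / h ^ 3)) / \<alpha>
      = (E - 1) / (2 * h)"
  proof -
    have "((1 + h * k)\<^sup>2 - E) - ((1 + h * (k - 1))\<^sup>2 - r\<^sup>2 * E) = h * (2 * h * k - \<alpha> * (E - 1))"
      unfolding h_eq alpha_eq by algebra
    then have "((1 + h * k)\<^sup>2 - E) / h ^ 3 - ((1 + h * (k - 1))\<^sup>2 - r\<^sup>2 * E) / h ^ 3
        = (2 * h * k - \<alpha> * (E - 1)) / h\<^sup>2"
      using h_pos by (simp add: diff_divide_distrib[symmetric] power2_eq_square power3_eq_cube)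
    then show ?thesis
      using h_pos alpha_pos by (simp add: field_simps power2_eq_square)
  qed
  also have "(E - 1) / (2 * h) - ((1 + h * k)\<^sup>2 - E) / h ^ 3 / d
        + ((1 + h * (k - 1))\<^sup>2 - r\<^sup>2 * E) / h ^ 3 / (d + 2)
      = (E * (2 + h * d)\<^sup>2 - (2 + h * (real n + k))\<^sup>2) / (2 * h ^ 3 * d * (d + 2))"
  proof -
    have "E * (2 + h * d)\<^sup>2 - (2 + h * (real n + k))\<^sup>2
        = h\<^sup>2 * d * (d + 2) * (E - 1) - 2 * (d + 2) * ((1 + h * k)\<^sup>2 - E)
          + 2 * d * ((1 + h * (k - 1))\<^sup>2 - r\<^sup>2 * E)"
      unfolding h_eq n by algebra
    moreover have "(E - 1) / (2 * h) - u / h ^ 3 / d + v / h ^ 3 / (d + 2)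
        = (h\<^sup>2 * d * (d + 2) * (E - 1) - 2 * (d + 2) * u + 2 * d * v) / (2 * h ^ 3 * d * (d + 2))"
      for u v
      using d h_pos by (simp add: divide_simps) (simp add: algebra_simps eval_nat_numeral)
    ultimately show ?thesis by (simp only:)
  qed
  finally show ?thesis by (simp only: E_def)
qed

text \<open>After taking logarithms, the claim compares \<open>ln ((c + x) / (c - x))\<close> at
  \<open>x = h * k\<close> with its chord from \<open>0\<close> to \<open>h * n\<close>. By the
  defining equation of \<open>r\<close> the value at \<open>h * n\<close> is
  \<open>- n * ln r\<close>.\<close>

lemma root_power_less:
  assumes "0 < k" "k < n"
  shows "r ^ k * (2 + h * (real n + real k)) < 2 + h * (real n - real k)"
proof -
  define c where "c = 2 + h * real n"
  have lt: "h * real k < h * real n" using assms h_pos by simp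
  have pos: "0 < h * real k" using assms h_pos by simp
  have "h * real n * (ln (c + h * real k) - ln (c - h * real k))
      < h * real k * (ln (c + h * real n) - ln (c - h * real n))"
    using lt pos by (intro ln_ratio_superlinear) (auto simp: c_def)
  also have "ln (c + h * real n) - ln (c - h * real n) = - (real n * ln r)"
  proof -
    have c: "c + h * real n = 2 * (1 + real n * h)" "c - h * real n = 2" by (simp_all add: c_def)
    have "ln (r ^ n * (1 + real n * h)) = 0" using r_root by (simp add: h_eq)
    moreover have X: "0 < 1 + real n * h" using h_pos by (simp add: add_pos_nonneg)
    moreover have "ln (2 * (1 + real n * h)) = ln 2 + ln (1 + real n * h)"
      using X by (intro ln_mult_pos) auto
    ultimately show ?thesis
      unfolding c using r_pos by (simp only: ln_mult_pos zero_less_power ln_realpow)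
  qed
  finally have "h * real n * (ln (c + h * real k) - ln (c - h * real k)) < h * real n * (- (real k * ln r))"
    by (simp add: mult_ac)
  then have "ln (c + h * real k) - ln (c - h * real k) < - (real k * ln r)"
    using mult_less_cancel_left_pos[of "h * real n"] pos lt by (meson less_trans)
  then have "ln (r ^ k * (c + h * real k)) < ln (c - h * real k)"
    using r_pos lt pos by (simp add: ln_mult ln_realpow c_def)
  then have "r ^ k * (c + h * real k) < c - h * real k"
    using r_pos lt pos by (subst (asm) ln_less_cancel_iff) (auto simp: c_def intro!: mult_pos_pos)
  then show ?thesis by (simp add: c_def algebra_simps)
qed

lemma adjacent_wt_pos:
  assumes "i + 2 \<le> n"
  shows "0 < adjacent_wt n i"
proof -
  define k where "k = real i + 1"
  define d where "d = real n - real i - 1"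
  have d: "0 < d" using assms by (simp add: d_def)
  have "r ^ (i + 1) * (2 + h * (real n + k)) < 2 + h * d"
    using root_power_less[of "i + 1"] assms by (simp add: k_def d_def diff_diff_eq add.commute)
  moreover have "0 \<le> r ^ (i + 1) * (2 + h * (real n + k))"
    using r_pos h_pos by (simp add: k_def)
  ultimately have "(r ^ (i + 1) * (2 + h * (real n + k)))\<^sup>2 < (2 + h * d)\<^sup>2"
    by (rule power_strict_mono) simp
  then have "(r\<^sup>2) ^ (i + 1) * (2 + h * (real n + k))\<^sup>2 < (2 + h * d)\<^sup>2"
    by (simp only: power_mult_distrib power_commutes power_mult[symmetric] mult.commute)
  then have "(2 + h * (real n + k))\<^sup>2 < (1 / r\<^sup>2) ^ (i + 1) * (2 + h * d)\<^sup>2"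
    using r_pos by (simp only: power_divide power_one) (simp add: divide_simps mult.commute)
  then show ?thesis
    unfolding adjacent_wt_eq[OF assms] k_def[symmetric] d_def[symmetric]
    using d h_pos by simp
qed

section \<open>The last suffix weight\<close>

text \<open>For smaller \<open>r\<close> the left side of the defining equation stays below
  \<open>(1 + 3 * n) / 4 ^ n\<close>, which is at most \<open>1\<close> by Bernoulli. The bound
  controls a coefficient of the last suffix weight.\<close>

lemma r_ge_quarter: "1 / 4 \<le> r"
proof (rule ccontr)
  assume *: "\<not> 1 / 4 \<le> r"
  have "r ^ n < (1 / 4) ^ n"
    using * r_pos n_pos by (intro power_strict_mono) auto
  moreover have "1 + real n * (1 + r) \<le> 1 + real n * 3"
    using r_less_1 by (intro add_left_mono mult_left_mono) auto
  moreover have "1 + real n * 3 \<le> 4 ^ n"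
    using Bernoulli_inequality[of 3 n] by simp
  ultimately have "r ^ n * (1 + real n * (1 + r)) < (1 / 4) ^ n * 4 ^ n"
    using r_pos by (intro mult_less_le_imp_less) (auto intro: add_pos_nonneg)
  then show False using r_root by (simp flip: power_mult_distrib)
qed

text \<open>With \<open>X = 1 + n * h\<close> the relation \<open>r ^ n * X = 1\<close> turns powers
  of \<open>1 / r\<close> near \<open>n\<close> into \<open>r ^ j * X\<close>. The case
  \<open>j = n + 1\<close> is needed when \<open>n = 2\<close>: it concerns \<open>F\<close> at
  \<open>-1\<close>, where the unclamped formula vanishes too.\<close>

lemma F_near_end:
  assumes "j \<le> n + 1"
  shows "h ^ 3 * F (int n - int j) = (1 + real n * h - real j * h)\<^sup>2 - (r ^ j * (1 + real n * h))\<^sup>2"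
proof -
  have H: "r ^ n * (1 + real n * h) = 1" using r_root by (simp add: h_eq)
  show ?thesis
  proof (cases "j = n + 1")
    case True
    have "r ^ j * (1 + real n * h) = r" using H True by simp
    moreover have "1 + real n * h - real j * h = - r" by (simp add: True h_eq algebra_simps)
    moreover have "F (int n - int j) = 0" by (simp add: F_def True)
    ultimately show ?thesis by simp
  next
    case False
    then have j: "int n - int j = int (n - j)" "real (n - j) = real n - real j" "n = j + (n - j)"
      using assms by auto
    have "(1 / r\<^sup>2) ^ (n - j) = (r ^ j * (1 + real n * h))\<^sup>2"
    proof -
      have "(r ^ (n - j) * (r ^ j * (1 + real n * h)))\<^sup>2 = 1"
        using H j(3) by (metis mult.assoc mult.commute one_power2 power_add)
      then have "(r\<^sup>2) ^ (n - j) * (r ^ j * (1 + real n * h))\<^sup>2 = 1"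
        by (simp only: power_mult_distrib power_mult[symmetric] mult.commute)
      then show ?thesis
        using r_pos by (simp add: power_divide divide_simps mult.commute)
    qed
    moreover have "1 + h * (real n - real j) = 1 + real n * h - real j * h" by algebra
    ultimately show ?thesis
      unfolding j(1) F_nat j(2) using h_pos by (simp only:) simp
  qed
qed

lemma suffix_wt_last_pos: "0 < suffix_wt n (n - 1)"
proof (cases "n = 1")
  case True
  then show ?thesis using alpha_pos by (simp add: suffix_wt_def)
next
  case False
  then have "2 \<le> n" using n_pos by linarith
  then obtain i where i: "n = i + 2" by (metis le_Suc_ex add.commute)
  define X where "X = 1 + real n * h"
  have n: "real n * h = X - 1" by (simp add: X_def)
  define A B C where "A = F (int i + 1)" and "B = F (int i)" and "C = F (int i - 1)"
  have A: "h ^ 3 * A = (X - h)\<^sup>2 - (r * X)\<^sup>2"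
    using F_near_end[of 1] i by (simp add: A_def X_def add.commute)
  have B: "h ^ 3 * B = (X - 2 * h)\<^sup>2 - (r\<^sup>2 * X)\<^sup>2"
    using F_near_end[of 2] i by (simp add: B_def X_def)
  have C: "h ^ 3 * C = (X - 3 * h)\<^sup>2 - (r ^ 3 * X)\<^sup>2"
    using F_near_end[of 3] i by (simp add: C_def X_def)
  have "(\<Sum>b<n - 1. p_rec n b * (real n - real b) * (\<alpha> - h / 2 * (real n - 1 - real b)))
      = (\<Sum>b\<le>i. \<alpha> * p_rec n b + (\<alpha> - h / 2) * (p_rec n b * (real i + 1 - real b))
          - h / 2 * (p_rec n b * (real i + 1 - real b)\<^sup>2))"
  proof (rule sum.cong)
    show "{..<n - 1} = {..i}" using i by auto
    have n: "real n = real i + 2" using i by simp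
    \<comment> \<open>\<open>n - 1 - b\<close> is \<open>i + 1 - b\<close> and \<open>n - b\<close>
      is one more, so besides the linear and square sums the plain sum of \<open>p_rec\<close>
      appears.\<close>
    show "p_rec n b * (real n - real b) * (\<alpha> - h / 2 * (real n - 1 - real b))
        = \<alpha> * p_rec n b + (\<alpha> - h / 2) * (p_rec n b * (real i + 1 - real b))
          - h / 2 * (p_rec n b * (real i + 1 - real b)\<^sup>2)" for b
      unfolding n by algebra
  qed
  also have "\<dots> = \<alpha> * (G (int i + 1) - 2 * G (int i) + G (int i - 1))
      + (\<alpha> - h / 2) * (G (int i + 1) - G (int i)) - h / 2 * (G (int i + 1) + G (int i))"
    using sum_p_rec[of i] i by (simp only: sum.distrib sum_subtractf sum_distrib_left[symmetric] order_refl)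
  also have "\<dots> = (2 * \<alpha> - h) * (A / 2) - 3 * \<alpha> * (B / 6) + \<alpha> * (C / 12)"
  proof -
    have n: "real n = real i + 2" using i by simp
    have G: "G (int i + 1) = A / 2" "G (int i) = B / 6" "G (int i - 1) = C / 12"
      by (simp_all add: G_def A_def B_def C_def n)
    show ?thesis unfolding G by (simp add: algebra_simps)
  qed
  finally have w: "suffix_wt n (n - 1)
      = 1 / \<alpha> * (real n - ((2 * \<alpha> - h) * (A / 2) - 3 * \<alpha> * (B / 6) + \<alpha> * (C / 12)))"
    using i by (simp add: suffix_wt_def)
  \<comment> \<open>The coefficient of \<open>X\<close> squared once the factor
    \<open>h * \<alpha>\<close> is taken out.\<close>
  define c where "c = 1 - (1 - r) * (13 / 12 - 5 / 12 * r\<^sup>2 + r ^ 4 / 12)"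
  have "h ^ 3 * (real n - ((2 * \<alpha> - h) * (A / 2) - 3 * \<alpha> * (B / 6) + \<alpha> * (C / 12)))
      = h\<^sup>2 * (real n * h) - (2 * \<alpha> - h) / 2 * (h ^ 3 * A) + \<alpha> / 2 * (h ^ 3 * B) - \<alpha> / 12 * (h ^ 3 * C)"
    by (simp add: algebra_simps power2_eq_square power3_eq_cube diff_divide_distrib)
  also have "\<dots> = h * (\<alpha> * (X / 2 - h / 4 + X\<^sup>2 * c))"
    unfolding A B C n unfolding c_def alpha_eq h_eq
    by (simp add: field_simps eval_nat_numeral)
  finally have "h ^ 3 * (real n - ((2 * \<alpha> - h) * (A / 2) - 3 * \<alpha> * (B / 6) + \<alpha> * (C / 12)))
      = h * (\<alpha> * (X / 2 - h / 4 + X\<^sup>2 * c))" .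
  moreover have "0 < X / 2 - h / 4 + X\<^sup>2 * c"
  proof -
    \<comment> \<open>From \<open>r\<close> at least \<open>1/4\<close> the product is at most
      \<open>13/16\<close>, so \<open>c\<close> is nonnegative; the remaining
      \<open>X / 2 - h / 4\<close> is positive because \<open>X\<close> is at least
      \<open>h\<close>.\<close>
    have "(1 - r) * (13 / 12 - 5 / 12 * r\<^sup>2 + r ^ 4 / 12) \<le> (3 / 4) * (13 / 12)"
    proof (rule mult_mono)
      have "r\<^sup>2 * r\<^sup>2 \<le> 1 * r\<^sup>2"
        using r_pos r_less_1 by (intro mult_right_mono) (auto simp: power_le_one)
      then have "r ^ 4 \<le> r\<^sup>2" by (simp add: power_add[symmetric] eval_nat_numeral)
      then show "13 / 12 - 5 / 12 * r\<^sup>2 + r ^ 4 / 12 \<le> 13 / 12"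
        using zero_le_power2[of r] by linarith
      have "r\<^sup>2 \<le> 1" using r_pos r_less_1 by (simp add: power_le_one)
      moreover have "0 \<le> r ^ 4" using r_pos by simp
      ultimately show "0 \<le> 13 / 12 - 5 / 12 * r\<^sup>2 + r ^ 4 / 12" by linarith
    qed (use r_ge_quarter in auto)
    then have "0 \<le> c" unfolding c_def by linarith
    then have "0 \<le> X\<^sup>2 * c" by simp
    moreover have "h \<le> X"
    proof -
      have "1 * h \<le> real n * h" using n_pos h_pos by (intro mult_right_mono) auto
      then show ?thesis unfolding X_def by linarith
    qed
    ultimately show ?thesis using h_pos by linarith
  qed
  ultimately have "0 < h ^ 3 * (real n - ((2 * \<alpha> - h) * (A / 2) - 3 * \<alpha> * (B / 6) + \<alpha> * (C / 12)))"
    using h_pos alpha_pos by simp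
  then show ?thesis unfolding w using h_pos alpha_pos by (simp add: zero_less_mult_iff)
qed

end

theorem theorem4p5:
  fixes n :: nat
  assumes "n \<ge> 1"
  shows "(\<forall>a. a \<le> n - 1 \<longrightarrow> suffix_wt n a > 0) \<and> (\<forall>i. i + 2 \<le> n \<longrightarrow> adjacent_wt n i > 0)"
proof -
  interpret weights n by unfold_locales (rule assms)
  have "0 < suffix_wt n a" if "a \<le> n - 1" for a
  proof (cases "a = n - 1")
    case False
    then have "a + 2 \<le> n" using that by linarith
    then show ?thesis using p_rec_pos by (simp add: suffix_wt_def)
  qed (use suffix_wt_last_pos in simp)
  then show ?thesis using adjacent_wt_pos by blast
qed

end
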